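(* Let $s\ge 2$ be an integer, let $\tau_0,\tau_1,\dots,\tau_{s-1}$ be real numbers and let $\theta\in[0,s-1]$. If $\theta=\tau_1+2\tau_2+\dots+(s-1)\tau_{s-1}$, then $$E[\tau_0,\tau_1,\dots,\tau_{s-1}]\subset S_\theta .$$
   Context: Every $x\in[0,1]$ has an $s$-nary representation $x=\sum_{k\ge 1}\alpha_k s^{-k}$ with $\alpha_k\in\{0,1,\dots,s-1\}$. If $x$ has two such representations, the one ending in zeros (period $(0)$) is used; the number $1$ has only the representation with all digits equal to $s-1$. Thus the $k$-th digit $\alpha_k(x)$ is well defined. For $i\in\{0,\dots,s-1\}$ put $N_i(x,k)=\#\{j\le k:\alpha_j(x)=i\}$. The frequency of digit $i$ in $x$ is $\nu_i(x)=\lim_{k\to\infty}N_i(x,k)/k$, if this limit exists. The Besicovitch–Eggleston set is $E[\tau_0,\dots,\tau_{s-1}]=\{x\in[0,1]:\nu_i(x)\text{ exists and }\nu_i(x)=\tau_i\text{ for all }i=0,\dots,s-1\}$. The set of numbers with prescribed asymptotic mean of digits is $S_\theta=\{x\in[0,1]:\lim_{n\to\infty}\frac1n\sum_{i=1}^n\alpha_i(x)\text{ exists and equals }\theta\}$. *)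

theory Defs
  imports Complex_Main
begin

text \<open>Digits are indexed from 1. The unused entry at index 0 is fixed to 0, so that two
  representations are equal as functions iff all their digits agree.\<close>

definition represents :: "nat \<Rightarrow> (nat \<Rightarrow> nat) \<Rightarrow> real \<Rightarrow> bool" where
  "represents s \<alpha> x \<longleftrightarrow>
     \<alpha> 0 = 0 \<and> (\<forall>k\<ge>1. \<alpha> k \<in> {0..s - 1}) \<and>
     (\<lambda>k. real (\<alpha> (Suc k)) / real s ^ Suc k) sums x"

definition ends_in_zeros :: "(nat \<Rightarrow> nat) \<Rightarrow> bool" where
  "ends_in_zeros \<alpha> \<longleftrightarrow> (\<exists>n. \<forall>k>n. \<alpha> k = 0)"

text \<open>If \<open>x\<close> has more than one representation, the one ending in zeros is chosen. The number 1
  has only the representation with all digits \<open>s - 1\<close>, and needs no separate case.\<close>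

definition standard_representation :: "nat \<Rightarrow> (nat \<Rightarrow> nat) \<Rightarrow> real \<Rightarrow> bool" where
  "standard_representation s \<alpha> x \<longleftrightarrow>
     represents s \<alpha> x \<and> ((\<exists>\<beta>. represents s \<beta> x \<and> \<beta> \<noteq> \<alpha>) \<longrightarrow> ends_in_zeros \<alpha>)"

definition digit :: "nat \<Rightarrow> real \<Rightarrow> nat \<Rightarrow> nat" where
  "digit s x = (THE \<alpha>. standard_representation s \<alpha> x)"

definition digit_count :: "nat \<Rightarrow> nat \<Rightarrow> real \<Rightarrow> nat \<Rightarrow> nat" where
  "digit_count s i x k = card {j \<in> {1..k}. digit s x j = i}"

definition has_digit_frequency :: "nat \<Rightarrow> nat \<Rightarrow> real \<Rightarrow> real \<Rightarrow> bool" where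
  "has_digit_frequency s i x \<nu> \<longleftrightarrow>
     (\<lambda>k. real (digit_count s i x k) / real k) \<longlonglongrightarrow> \<nu>"

definition besicovitch_eggleston :: "nat \<Rightarrow> (nat \<Rightarrow> real) \<Rightarrow> real set" where
  "besicovitch_eggleston s \<tau> = {x \<in> {0..1}. \<forall>i<s. has_digit_frequency s i x (\<tau> i)}"

definition digit_mean_set :: "nat \<Rightarrow> real \<Rightarrow> real set" where
  "digit_mean_set s \<theta> =
     {x \<in> {0..1}. (\<lambda>n. (\<Sum>i = 1..n. real (digit s x i)) / real n) \<longlonglongrightarrow> \<theta>}"

end

theory Submission
  imports Defs
begin

text \<open>Among the first \<open>n\<close> digits, \<open>i\<close> contributes \<open>i N\<^sub>i(x,n)\<close> to the digit sum, so the digit mean is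
  the finite sum \<open>\<Sum>i<s. i N\<^sub>i(x,n)/n\<close>, and one passes to the limit termwise. This needs the digits
  to lie below \<open>s\<close>, that is, the existence and uniqueness of the standard representation. Both follow
  from one observation: of two representations of \<open>x\<close> that first differ at \<open>n\<close>, the one with
  the larger \<open>n\<close>-th digit continues with zeros only, the other with digits \<open>s - 1\<close> only.\<close>

text \<open>With all digits after place \<open>m\<close> equal to \<open>s - 1\<close>, the tail is
  as large as it can be, and it makes up exactly one unit of place \<open>m\<close>.\<close>

lemma geometric_tail_sums:
  assumes "s \<ge> 2"
  shows "(\<lambda>k. (real s - 1) / real s ^ Suc (k + m)) sums (1 / real s ^ m)"
proof -
  have "(\<lambda>k. (1 / real s) ^ k) sums (1 / (1 - 1 / real s))"
    using assms by (intro geometric_sums) auto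
  from sums_mult[OF this, of "(real s - 1) / real s ^ Suc m"]
  have "(\<lambda>k. (real s - 1) / real s ^ Suc m * (1 / real s) ^ k) sums
    ((real s - 1) / real s ^ Suc m * (1 / (1 - 1 / real s)))" .
  moreover have "(real s - 1) / real s ^ Suc m * (1 / real s) ^ k = (real s - 1) / real s ^ Suc (k + m)" for k
    by (simp add: power_add power_one_over field_simps)
  moreover have "(real s - 1) / real s ^ Suc m * (1 / (1 - 1 / real s)) = 1 / real s ^ m"
    using assms by (simp add: field_simps)
  ultimately show ?thesis by simp
qed

text \<open>The integer digits at place \<open>n\<close> differ by at least 1, which puts
  \<open>\<beta>\<close> ahead by at least \<open>1 / s ^ n\<close>. The later digits must make up
  for this. They can regain at most that amount, and only if those of \<open>\<alpha>\<close> are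
  all maximal and those of \<open>\<beta>\<close> all zero.\<close>

lemma represents_first_difference:
  assumes s: "s \<ge> 2" and "represents s \<alpha> x" "represents s \<beta> x"
    and eq: "\<And>j. j < n \<Longrightarrow> \<alpha> j = \<beta> j" and less: "\<alpha> n < \<beta> n" and "k > n"
  shows "\<alpha> k = s - 1" and "\<beta> k = 0"
proof -
  have A: "\<alpha> j \<le> s - 1" "\<beta> j \<le> s - 1" if "j \<ge> 1" for j
    using assms(2,3) that by (auto simp: represents_def)
  \<comment> \<open>Index 0 carries no digit: both entries there are fixed to 0.\<close>
  have "n \<noteq> 0" using assms(2,3) less by (auto simp: represents_def intro: gr0I)
  then obtain m where n: "n = Suc m" by (cases n) auto
  define d where "d i = (real (\<beta> (Suc i)) - real (\<alpha> (Suc i))) / real s ^ Suc i" for i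
  have "d sums (x - x)"
    unfolding d_def diff_divide_distrib
    using assms(2,3) by (intro sums_diff) (auto simp: represents_def)
  from sums_split_initial_segment[OF this, of "Suc m"]
  have "(\<lambda>i. d (i + Suc m)) sums (- (\<Sum>i<Suc m. d i))" by simp
  also have "(\<Sum>i<Suc m. d i) = d m"
    using eq by (simp add: d_def n)
  finally have tail: "(\<lambda>i. d (i + Suc m)) sums (- d m)" .
  \<comment> \<open>Adding the maximal tail makes every term nonnegative. The total turns out to be
    at most 0, so each term vanishes.\<close>
  define e where "e i = d (i + Suc m) + (real s - 1) / real s ^ Suc (i + Suc m)" for i
  have e: "e sums (- d m + 1 / real s ^ Suc m)"
    unfolding e_def by (intro sums_add tail geometric_tail_sums s)
  have e_alt: "e i = (real (\<beta> (i + Suc n)) + (real (s - 1) - real (\<alpha> (i + Suc n)))) / real s ^ (i + Suc n)" for i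
    using s by (simp add: e_def d_def n add_divide_distrib diff_divide_distrib of_nat_diff)
  have nonneg: "e i \<ge> 0" for i
    unfolding e_alt using A(1)[of "i + Suc n"] by (intro divide_nonneg_nonneg) auto
  have "1 \<le> real (\<beta> n) - real (\<alpha> n)" using less by linarith
  then have "- d m + 1 / real s ^ Suc m \<le> 0"
    unfolding d_def n[symmetric] by (simp add: divide_right_mono)
  then have "suminf e \<le> 0" using e by (simp add: sums_iff)
  then have "suminf e = 0"
    using suminf_nonneg[OF sums_summable[OF e] nonneg] by linarith
  then have zero: "e i = 0" for i
    using suminf_eq_zero_iff[OF sums_summable[OF e] nonneg] by simp
  have "e (k - Suc n) = 0" by (rule zero)
  then have "real (\<beta> k) + (real (s - 1) - real (\<alpha> k)) = 0"
    using \<open>k > n\<close> s by (simp add: e_alt)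
  moreover have "\<alpha> k \<le> s - 1" using A(1) \<open>k > n\<close> by simp
  ultimately show "\<alpha> k = s - 1" "\<beta> k = 0" by linarith+
qed

text \<open>The previous lemma applies at the least index of disagreement, in one of the two orders.
  Since \<open>s \<ge> 2\<close>, a tail of digits \<open>s - 1\<close> is not a tail of
  zeros.\<close>

lemma distinct_representations:
  assumes "s \<ge> 2" "represents s \<alpha> x" "represents s \<beta> x" "\<alpha> \<noteq> \<beta>"
  shows "ends_in_zeros \<alpha> \<longleftrightarrow> \<not> ends_in_zeros \<beta>"
proof -
  have *: "ends_in_zeros \<delta> \<and> \<not> ends_in_zeros \<gamma>"
    if "represents s \<gamma> x" "represents s \<delta> x" "\<And>j. j < n \<Longrightarrow> \<gamma> j = \<delta> j" "\<gamma> n < \<delta> n" for \<gamma> \<delta> n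
  proof -
    have tails: "\<gamma> k = s - 1" "\<delta> k = 0" if "k > n" for k
      using represents_first_difference[OF assms(1) \<open>represents s \<gamma> x\<close> \<open>represents s \<delta> x\<close>] that
        \<open>\<gamma> n < \<delta> n\<close> \<open>\<And>j. j < n \<Longrightarrow> \<gamma> j = \<delta> j\<close> by blast+
    have "\<not> ends_in_zeros \<gamma>"
    proof
      assume "ends_in_zeros \<gamma>"
      then obtain m where "\<And>k. k > m \<Longrightarrow> \<gamma> k = 0" by (auto simp: ends_in_zeros_def)
      then have "\<gamma> (Suc (m + n)) = 0" by simp
      moreover have "\<gamma> (Suc (m + n)) = s - 1" by (rule tails(1)) simp
      ultimately show False using assms(1) by simp
    qed
    then show ?thesis using tails(2) by (auto simp: ends_in_zeros_def)
  qed
  define n where "n = (LEAST j. \<alpha> j \<noteq> \<beta> j)"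
  have "\<exists>j. \<alpha> j \<noteq> \<beta> j" using assms(4) by auto
  then have "\<alpha> n \<noteq> \<beta> n" unfolding n_def by (rule LeastI_ex)
  moreover have "\<alpha> j = \<beta> j" if "j < n" for j
    using not_less_Least that unfolding n_def by blast
  ultimately show ?thesis
    using *[of \<alpha> \<beta> n] *[of \<beta> \<alpha> n] assms(2,3) by (metis nat_neq_iff)
qed

text \<open>The digits come from differences of consecutive approximations
  \<open>c k / s ^ k\<close>, so their series telescopes to the limit \<open>x\<close>. The
  preference for zeros is left to the next lemma.\<close>

lemma represents_exists:
  assumes s: "s \<ge> 2" and x: "x \<in> {0..1}"
  shows "\<exists>\<alpha>. represents s \<alpha> x"
proof -
  \<comment> \<open>Rounding up, rather than taking \<open>\<lfloor>x s\<^sup>k\<rfloor>\<close>, also covers \<open>x = 1\<close>.\<close>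
  define c where "c k = max 0 (\<lceil>x * real s ^ k\<rceil> - 1)" for k
  define \<alpha> where "\<alpha> k = (case k of 0 \<Rightarrow> 0 | Suc j \<Rightarrow> nat (c (Suc j) - int s * c j))" for k
  have c0: "c 0 = 0" using x by (simp add: c_def ceiling_le_iff)
  \<comment> \<open>Because of these bounds, \<open>nat\<close> in \<open>\<alpha>\<close> truncates
    nothing. The \<open>max 0\<close> in \<open>c\<close> acts only for \<open>x = 0\<close>;
    otherwise the ceilings are at least 1.\<close>
  have step: "0 \<le> c (Suc k) - int s * c k \<and> c (Suc k) - int s * c k \<le> int s - 1" for k
  proof (cases "x = 0")
    case True
    then show ?thesis using s by (simp add: c_def)
  next
    case False
    define y where "y = x * real s ^ k"
    have "y > 0" using False x s by (simp add: y_def)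
    have "\<lceil>y\<rceil> \<ge> 1" "\<lceil>real s * y\<rceil> \<ge> 1" using \<open>y > 0\<close> s by simp_all
    then have ck: "c k = \<lceil>y\<rceil> - 1" "c (Suc k) = \<lceil>real s * y\<rceil> - 1"
      by (simp_all add: c_def y_def mult_ac)
    \<comment> \<open>Both bounds come from multiplying
      \<open>\<lceil>y\<rceil> - 1 < y \<le> \<lceil>y\<rceil>\<close> by \<open>s\<close>.\<close>
    have "int s * (\<lceil>y\<rceil> - 1) < \<lceil>real s * y\<rceil>"
      using s \<open>y > 0\<close> by (simp add: less_ceiling_iff) linarith
    moreover have "\<lceil>real s * y\<rceil> \<le> int s * \<lceil>y\<rceil>"
      using s by (simp add: ceiling_le_iff)
    ultimately show ?thesis by (simp add: ck algebra_simps)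
  qed
  have "(\<lambda>k. real_of_int (c k) / real s ^ k) \<longlonglongrightarrow> x"
  proof (rule real_tendsto_sandwich)
    have pos: "real s ^ k > 0" for k using s by simp
    have "(\<lambda>k. x - (1 / real s) ^ k) \<longlonglongrightarrow> x - 0"
      using s by (intro tendsto_intros LIMSEQ_realpow_zero) auto
    then show "(\<lambda>k. x - (1 / real s) ^ k) \<longlonglongrightarrow> x" by simp
    show "(\<lambda>k. x) \<longlonglongrightarrow> x" by simp
    show "\<forall>\<^sub>F k in sequentially. x - (1 / real s) ^ k \<le> real_of_int (c k) / real s ^ k"
    proof (intro always_eventually allI)
      fix k
      have "x * real s ^ k - 1 \<le> real_of_int (c k)" unfolding c_def by linarith
      then have "(x * real s ^ k - 1) / real s ^ k \<le> real_of_int (c k) / real s ^ k"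
        using pos[of k] by (intro divide_right_mono) auto
      then show "x - (1 / real s) ^ k \<le> real_of_int (c k) / real s ^ k"
        using s by (simp add: diff_divide_distrib power_one_over)
    qed
    show "\<forall>\<^sub>F k in sequentially. real_of_int (c k) / real s ^ k \<le> x"
    proof (intro always_eventually allI)
      fix k
      have "0 \<le> x * real s ^ k" using x by simp
      then have "real_of_int (c k) \<le> x * real s ^ k" unfolding c_def by linarith
      then show "real_of_int (c k) / real s ^ k \<le> x"
        using pos[of k] by (simp add: field_simps)
    qed
  qed
  from telescope_sums[OF this]
  have "(\<lambda>k. real_of_int (c (Suc k)) / real s ^ Suc k - real_of_int (c k) / real s ^ k) sums x"
    by (simp add: c0)
  moreover have "real_of_int (c (Suc k)) / real s ^ Suc k - real_of_int (c k) / real s ^ k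
      = real (\<alpha> (Suc k)) / real s ^ Suc k" for k
    using step[of k] s by (simp add: \<alpha>_def field_simps)
  ultimately have "(\<lambda>k. real (\<alpha> (Suc k)) / real s ^ Suc k) sums x" by simp
  moreover have "\<alpha> k \<le> s - 1" if "k \<ge> 1" for k
    using step[of "k - 1"] that by (cases k) (auto simp: \<alpha>_def)
  moreover have "\<alpha> 0 = 0" by (simp add: \<alpha>_def)
  ultimately show ?thesis unfolding represents_def by auto
qed

text \<open>If a representation is not standard, then it has a rival and does not end in zeros, so
  the rival does and is standard. Two different standard ones would both end in zeros, which is
  impossible.\<close>

lemma ex1_standard_representation:
  assumes s: "s \<ge> 2" and x: "x \<in> {0..1}"
  shows "\<exists>!\<alpha>. standard_representation s \<alpha> x"
proof (rule ex_ex1I)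
  obtain \<alpha> where "represents s \<alpha> x" using represents_exists[OF assms] by blast
  then show "\<exists>\<alpha>. standard_representation s \<alpha> x"
    using distinct_representations[OF s] unfolding standard_representation_def by metis
next
  fix \<alpha> \<beta>
  assume "standard_representation s \<alpha> x" "standard_representation s \<beta> x"
  then show "\<alpha> = \<beta>"
    using distinct_representations[OF s] unfolding standard_representation_def by metis
qed

lemma digit_less:
  assumes "s \<ge> 2" "x \<in> {0..1}" "k \<ge> 1"
  shows "digit s x k < s"
proof -
  have "standard_representation s (digit s x) x"
    unfolding digit_def using ex1_standard_representation[OF assms(1,2)] by (rule theI')
  then have "digit s x k \<in> {0..s - 1}"
    using assms(3) unfolding standard_representation_def represents_def by blast
  then show ?thesis using assms(1) by simp
qed

lemma sum_digits_eq_sum_digit_count: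
  assumes "s \<ge> 2" "x \<in> {0..1}"
  shows "(\<Sum>j = 1..n. real (digit s x j)) = (\<Sum>i<s. real i * real (digit_count s i x n))"
proof -
  have "(\<Sum>j = 1..n. real (digit s x j)) =
      (\<Sum>i<s. \<Sum>j | j \<in> {1..n} \<and> digit s x j = i. real (digit s x j))"
    \<comment> \<open>Every place falls into a group \<open>i < s\<close> only because its digit is
      below \<open>s\<close>.\<close>
    using digit_less[OF assms] by (intro sum.group[symmetric]) auto
  also have "\<dots> = (\<Sum>i<s. real i * real (digit_count s i x n))"
    by (intro sum.cong) (auto simp: digit_count_def)
  finally show ?thesis .
qed

theorem corollary1:
  fixes s :: nat and \<tau> :: "nat \<Rightarrow> real" and \<theta> :: real
  assumes "s \<ge> 2"
    and "\<theta> \<in> {0..real s - 1}"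
    and "\<theta> = (\<Sum>i = 1..s - 1. real i * \<tau> i)"
  shows "besicovitch_eggleston s \<tau> \<subseteq> digit_mean_set s \<theta>"
proof
  fix x
  assume "x \<in> besicovitch_eggleston s \<tau>"
  then have x: "x \<in> {0..1}" and
    freq: "\<And>i. i < s \<Longrightarrow> (\<lambda>n. real (digit_count s i x n) / real n) \<longlonglongrightarrow> \<tau> i"
    by (auto simp: besicovitch_eggleston_def has_digit_frequency_def)
  have "(\<lambda>n. \<Sum>i<s. real i * (real (digit_count s i x n) / real n)) \<longlonglongrightarrow> (\<Sum>i<s. real i * \<tau> i)"
    using freq by (intro tendsto_intros) auto
  \<comment> \<open>The ranges differ by \<open>i = 0\<close>, whose term is 0.\<close>
  moreover have "(\<Sum>i<s. real i * \<tau> i) = \<theta>"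
    unfolding assms(3) using assms(1) by (intro sum.mono_neutral_right) auto
  ultimately show "x \<in> digit_mean_set s \<theta>"
    using x by (simp add: digit_mean_set_def sum_digits_eq_sum_digit_count[OF assms(1) x]
        flip: sum_divide_distrib del: One_nat_def)
qed

end
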